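(* The functor $\Phi\colon \mathbf{Grp}^{\mathrm{op}}\to \mathbf{Comonads}(\mathbf{Set})$, $G\mapsto K_G$, is full. More precisely, if $G$ and $H$ are groups and $\alpha\colon K_H\Rightarrow K_G$ is any morphism of comonads, then there exists a unique group morphism $f\colon G\to H$ such that $\alpha=\Phi(f)$.
   Context: For a group $G$, the comonad $K_G=(K_G,\epsilon^G,\delta^G)$ on $\mathbf{Set}$ is given by: $K_G(X)=X^G$, the set of all functions $G\to X$; $K_G(f)(\phi)=f\circ\phi$ for a map $f\colon X\to Y$; counit $\epsilon^G_X\colon X^G\to X$, $\epsilon^G_X(\phi)=\phi(e_G)$; comultiplication $\delta^G_X\colon X^G\to (X^G)^G$, $\delta^G_X(\phi)(g)(h)=\phi(gh)$. A morphism of comonads $(K,\epsilon,\delta)\to(K',\epsilon',\delta')$ on a category is a natural transformation $\phi\colon K\Rightarrow K'$ with $\epsilon'\circ\phi=\epsilon$ and $\delta'\circ\phi=(\phi\phi)\circ\delta$, where $\phi\phi\colon K^2\Rightarrow K'^2$ is the horizontal composite. $\mathbf{Comonads}(\mathbf{Set})$ is the category of comonads on $\mathbf{Set}$ and morphisms of comonads. The functor $\Phi$ sends $G$ to $K_G$ and a group morphism $f\colon G\to H$ to the comonad morphism $\Phi(f)\colon K_H\Rightarrow K_G$ with components $\Phi(f)_X(\psi)=\psi\circ f$ for $\psi\in X^H$. *)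

theory Defs
  imports "HOL-Algebra.Group" "HOL-Library.FuncSet" "HOL-Library.Equipollence"
begin

text \<open>
  Categories are given by hom-sets. Hom-sets of different pairs of objects may overlap, so
  composition and the action of a functor on arrows take the objects involved as arguments;
  \<open>Cmp C X Y Z g f\<close> is the composite of \<open>f : X \<rightarrow> Y\<close> and \<open>g : Y \<rightarrow> Z\<close>.
\<close>

record ('o, 'm) cat =
  Ob :: "'o set"
  Hom :: "'o \<Rightarrow> 'o \<Rightarrow> 'm set"
  Idn :: "'o \<Rightarrow> 'm"
  Cmp :: "'o \<Rightarrow> 'o \<Rightarrow> 'o \<Rightarrow> 'm \<Rightarrow> 'm \<Rightarrow> 'm"

locale category =
  fixes C :: "('o, 'm) cat"
  assumes Idn_in: "X \<in> Ob C \<Longrightarrow> Idn C X \<in> Hom C X X"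
    and Cmp_in: "\<lbrakk>X \<in> Ob C; Y \<in> Ob C; Z \<in> Ob C; f \<in> Hom C X Y; g \<in> Hom C Y Z\<rbrakk>
      \<Longrightarrow> Cmp C X Y Z g f \<in> Hom C X Z"
    and Cmp_Idn_left: "\<lbrakk>X \<in> Ob C; Y \<in> Ob C; f \<in> Hom C X Y\<rbrakk> \<Longrightarrow> Cmp C X Y Y (Idn C Y) f = f"
    and Cmp_Idn_right: "\<lbrakk>X \<in> Ob C; Y \<in> Ob C; f \<in> Hom C X Y\<rbrakk> \<Longrightarrow> Cmp C X X Y f (Idn C X) = f"
    and Cmp_assoc: "\<lbrakk>W \<in> Ob C; X \<in> Ob C; Y \<in> Ob C; Z \<in> Ob C;
        f \<in> Hom C W X; g \<in> Hom C X Y; h \<in> Hom C Y Z\<rbrakk>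
      \<Longrightarrow> Cmp C W X Z (Cmp C X Y Z h g) f = Cmp C W Y Z h (Cmp C W X Y g f)"

definition op_cat :: "('o, 'm) cat \<Rightarrow> ('o, 'm) cat" where
  "op_cat C = \<lparr>Ob = Ob C, Hom = (\<lambda>X Y. Hom C Y X), Idn = Idn C,
     Cmp = (\<lambda>X Y Z g f. Cmp C Z Y X f g)\<rparr>"

record ('o, 'm, 'p, 'n) func =
  on_ob :: "'o \<Rightarrow> 'p"
  on_hom :: "'o \<Rightarrow> 'o \<Rightarrow> 'm \<Rightarrow> 'n"

locale is_functor = dom: category C + cod: category D
  for C :: "('o, 'm) cat" and D :: "('p, 'n) cat" +
  fixes F :: "('o, 'm, 'p, 'n) func"
  assumes on_ob_in: "X \<in> Ob C \<Longrightarrow> on_ob F X \<in> Ob D"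
    and on_hom_in: "\<lbrakk>X \<in> Ob C; Y \<in> Ob C; f \<in> Hom C X Y\<rbrakk>
      \<Longrightarrow> on_hom F X Y f \<in> Hom D (on_ob F X) (on_ob F Y)"
    and on_hom_Idn: "X \<in> Ob C \<Longrightarrow> on_hom F X X (Idn C X) = Idn D (on_ob F X)"
    and on_hom_Cmp: "\<lbrakk>X \<in> Ob C; Y \<in> Ob C; Z \<in> Ob C; f \<in> Hom C X Y; g \<in> Hom C Y Z\<rbrakk>
      \<Longrightarrow> on_hom F X Z (Cmp C X Y Z g f)
        = Cmp D (on_ob F X) (on_ob F Y) (on_ob F Z) (on_hom F Y Z g) (on_hom F X Y f)"

definition full :: "('o, 'm) cat \<Rightarrow> ('p, 'n) cat \<Rightarrow> ('o, 'm, 'p, 'n) func \<Rightarrow> bool" where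
  "full C D F \<longleftrightarrow> (\<forall>X\<in>Ob C. \<forall>Y\<in>Ob C. \<forall>b\<in>Hom D (on_ob F X) (on_ob F Y).
     \<exists>f\<in>Hom C X Y. on_hom F X Y f = b)"

definition id_func :: "('o, 'm, 'o, 'm) func" where
  "id_func = \<lparr>on_ob = (\<lambda>X. X), on_hom = (\<lambda>X Y f. f)\<rparr>"

definition comp_func ::
  "('p, 'n, 'q, 'k) func \<Rightarrow> ('o, 'm, 'p, 'n) func \<Rightarrow> ('o, 'm, 'q, 'k) func" where
  "comp_func G F = \<lparr>on_ob = (\<lambda>X. on_ob G (on_ob F X)),
     on_hom = (\<lambda>X Y f. on_hom G (on_ob F X) (on_ob F Y) (on_hom F X Y f))\<rparr>"

text \<open>Families indexed by objects are \<open>undefined\<close> outside \<open>Ob C\<close>, so that \<open>=\<close> is equality of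
  natural transformations.\<close>

definition nat_trans :: "('o, 'm) cat \<Rightarrow> ('p, 'n) cat \<Rightarrow> ('o, 'm, 'p, 'n) func
    \<Rightarrow> ('o, 'm, 'p, 'n) func \<Rightarrow> ('o \<Rightarrow> 'n) set" where
  "nat_trans C D F G = {a \<in> extensional (Ob C).
     (\<forall>X\<in>Ob C. a X \<in> Hom D (on_ob F X) (on_ob G X)) \<and>
     (\<forall>X\<in>Ob C. \<forall>Y\<in>Ob C. \<forall>f\<in>Hom C X Y.
        Cmp D (on_ob F X) (on_ob F Y) (on_ob G Y) (a Y) (on_hom F X Y f)
      = Cmp D (on_ob F X) (on_ob G X) (on_ob G Y) (on_hom G X Y f) (a X))}"

text \<open>Horizontal composite of \<open>a : F \<Rightarrow> F'\<close> (between functors into \<open>D\<close>) and \<open>b : G \<Rightarrow> G'\<close>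
  (between functors from \<open>D\<close> to \<open>E\<close>).\<close>

definition hcomp :: "('o, 'm) cat \<Rightarrow> ('q, 'k) cat
    \<Rightarrow> ('o, 'm, 'p, 'n) func \<Rightarrow> ('o, 'm, 'p, 'n) func
    \<Rightarrow> ('p, 'n, 'q, 'k) func \<Rightarrow> ('p, 'n, 'q, 'k) func
    \<Rightarrow> ('p \<Rightarrow> 'k) \<Rightarrow> ('o \<Rightarrow> 'n) \<Rightarrow> 'o \<Rightarrow> 'k" where
  "hcomp C E F F' G G' b a = (\<lambda>X\<in>Ob C.
     Cmp E (on_ob G (on_ob F X)) (on_ob G (on_ob F' X)) (on_ob G' (on_ob F' X))
       (b (on_ob F' X)) (on_hom G (on_ob F X) (on_ob F' X) (a X)))"

record ('o, 'm) comonad_data =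
  endo :: "('o, 'm, 'o, 'm) func"
  counit :: "'o \<Rightarrow> 'm"
  comult :: "'o \<Rightarrow> 'm"

locale comonad = is_functor C C "endo K"
  for C :: "('o, 'm) cat" and K :: "('o, 'm) comonad_data" +
  assumes counit_nat: "counit K \<in> nat_trans C C (endo K) id_func"
    and comult_nat: "comult K \<in> nat_trans C C (endo K) (comp_func (endo K) (endo K))"
    and counit_left: "\<lbrakk>X \<in> Ob C; KX = on_ob (endo K) X; KKX = on_ob (endo K) KX\<rbrakk>
      \<Longrightarrow> Cmp C KX KKX KX (counit K KX) (comult K X) = Idn C KX"
    and counit_right: "\<lbrakk>X \<in> Ob C; KX = on_ob (endo K) X; KKX = on_ob (endo K) KX\<rbrakk>
      \<Longrightarrow> Cmp C KX KKX KX (on_hom (endo K) KX X (counit K X)) (comult K X) = Idn C KX"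
    and coassoc: "\<lbrakk>X \<in> Ob C; KX = on_ob (endo K) X; KKX = on_ob (endo K) KX;
        KKKX = on_ob (endo K) KKX\<rbrakk>
      \<Longrightarrow> Cmp C KX KKX KKKX (comult K KX) (comult K X)
        = Cmp C KX KKX KKKX (on_hom (endo K) KX KKX (comult K X)) (comult K X)"

definition comonad_hom :: "('o, 'm) cat \<Rightarrow> ('o, 'm) comonad_data \<Rightarrow> ('o, 'm) comonad_data
    \<Rightarrow> ('o \<Rightarrow> 'm) set" where
  "comonad_hom C K K' = {a \<in> nat_trans C C (endo K) (endo K').
     (\<forall>X\<in>Ob C. Cmp C (on_ob (endo K) X) (on_ob (endo K') X) X (counit K' X) (a X) = counit K X) \<and>
     (\<forall>X\<in>Ob C.
        Cmp C (on_ob (endo K) X) (on_ob (endo K') X) (on_ob (endo K') (on_ob (endo K') X))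
          (comult K' X) (a X)
      = Cmp C (on_ob (endo K) X) (on_ob (endo K) (on_ob (endo K) X))
          (on_ob (endo K') (on_ob (endo K') X))
          (hcomp C C (endo K) (endo K') (endo K) (endo K') a a X) (comult K X))}"

definition Comonads :: "('o, 'm) cat \<Rightarrow> (('o, 'm) comonad_data, 'o \<Rightarrow> 'm) cat" where
  "Comonads C = \<lparr>Ob = {K. comonad C K}, Hom = comonad_hom C,
     Idn = (\<lambda>K. \<lambda>X\<in>Ob C. Idn C (on_ob (endo K) X)),
     Cmp = (\<lambda>K L M b a. \<lambda>X\<in>Ob C.
       Cmp C (on_ob (endo K) X) (on_ob (endo L) X) (on_ob (endo M) X) (b X) (a X))\<rparr>"

text \<open>
  HOL cannot quantify over all sets of all types inside a formula, so \<open>Set\<close> and \<open>Grp\<close> are taken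
  relative to an arbitrary universe: \<open>\<S>\<close> is the class of sets, \<open>\<G>\<close> the class of carriers of
  groups, and \<open>code\<close> represents functions in \<open>X\<^sup>C\<close> as points, so that \<open>X\<^sup>C\<close> is again (up to
  bijection) in \<open>\<S>\<close>. A universe of small sets closed under function spaces is the case
  \<open>\<G> = \<S>\<close>. Exponents from \<open>\<G>\<close> are all that is needed, and with this restriction suitable
  universes exist in HOL for all groups over any type (\<open>set_universe_ex\<close> below).
\<close>

locale set_universe =
  fixes \<G> :: "'g set set" and \<S> :: "'u set set" and code :: "('g \<Rightarrow> 'u) \<Rightarrow> 'u"
  assumes code_inj: "\<lbrakk>C \<in> \<G>; X \<in> \<S>\<rbrakk> \<Longrightarrow> inj_on code (C \<rightarrow>\<^sub>E X)"
    and code_in: "\<lbrakk>C \<in> \<G>; X \<in> \<S>\<rbrakk> \<Longrightarrow> code ` (C \<rightarrow>\<^sub>E X) \<in> \<S>"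
    and carrier_eqpoll: "C \<in> \<G> \<Longrightarrow> \<exists>X\<in>\<S>. X \<approx> C"

text \<open>For any type \<open>'g\<close> all subsets of \<open>'g\<close> can be carriers, and for any type \<open>'x\<close> the class \<open>\<S>\<close>
  can be taken to be all subsets of a type that contains a copy of \<open>'x\<close>.\<close>

lemma set_universe_ex:
  "set_universe (UNIV :: 'g set set) (UNIV :: ('g list \<times> 'x) set set set)
     (\<lambda>p. {(g # l, x) | g l x. (l, x) \<in> p g})"
  "inj (\<lambda>x::'x. {([] :: 'g list, x)})"
proof -
  let ?code = "\<lambda>p :: 'g \<Rightarrow> ('g list \<times> 'x) set. {(g # l, x) | g l x. (l, x) \<in> p g}"
  have "inj ?code"
  proof (rule injI)
    fix p q assume eq: "?code p = ?code q"
    have "(l, x) \<in> p g \<longleftrightarrow> (l, x) \<in> q g" for g l x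
      using arg_cong[OF eq, of "\<lambda>S. (g # l, x) \<in> S"] by simp
    then show "p = q" by (intro ext) auto
  qed
  moreover have "\<exists>X :: ('g list \<times> 'x) set set. X \<approx> C" for C :: "'g set"
  proof -
    have "inj_on (\<lambda>g. {([g], undefined :: 'x)}) C" by (auto intro: inj_onI)
    then show ?thesis using inj_on_image_eqpoll_self by blast
  qed
  ultimately show "set_universe (UNIV :: 'g set set) (UNIV :: ('g list \<times> 'x) set set set) ?code"
    by unfold_locales (auto intro: inj_on_subset)
  show "inj (\<lambda>x::'x. {([] :: 'g list, x)})"
    by (auto intro: injI)
qed

definition Set_cat :: "'u set set \<Rightarrow> ('u set, 'u \<Rightarrow> 'u) cat" where
  "Set_cat \<S> = \<lparr>Ob = \<S>, Hom = (\<lambda>X Y. X \<rightarrow>\<^sub>E Y), Idn = (\<lambda>X. \<lambda>x\<in>X. x),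
     Cmp = (\<lambda>X Y Z g f. compose X g f)\<rparr>"

definition Grp_cat :: "'g set set \<Rightarrow> ('g monoid, 'g \<Rightarrow> 'g) cat" where
  "Grp_cat \<G> = \<lparr>Ob = {G. group G \<and> carrier G \<in> \<G>},
     Hom = (\<lambda>G H. hom G H \<inter> extensional (carrier G)),
     Idn = (\<lambda>G. \<lambda>x\<in>carrier G. x),
     Cmp = (\<lambda>G H L g f. compose (carrier G) g f)\<rparr>"

text \<open>The set \<open>X\<^sup>G\<close>, with its elements represented by their codes, and the function with a given
  code.\<close>

definition power_set :: "(('g \<Rightarrow> 'u) \<Rightarrow> 'u) \<Rightarrow> 'g monoid \<Rightarrow> 'u set \<Rightarrow> 'u set" where
  "power_set code G X = code ` (carrier G \<rightarrow>\<^sub>E X)"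

definition decode :: "(('g \<Rightarrow> 'u) \<Rightarrow> 'u) \<Rightarrow> 'g monoid \<Rightarrow> 'u set \<Rightarrow> 'u \<Rightarrow> 'g \<Rightarrow> 'u" where
  "decode code G X = inv_into (carrier G \<rightarrow>\<^sub>E X) code"

definition K_func :: "(('g \<Rightarrow> 'u) \<Rightarrow> 'u) \<Rightarrow> 'g monoid
    \<Rightarrow> ('u set, 'u \<Rightarrow> 'u, 'u set, 'u \<Rightarrow> 'u) func" where
  "K_func code G = \<lparr>on_ob = power_set code G,
     on_hom = (\<lambda>X Y f. \<lambda>p\<in>power_set code G X.
       code (compose (carrier G) f (decode code G X p)))\<rparr>"

definition K_comonad :: "'u set set \<Rightarrow> (('g \<Rightarrow> 'u) \<Rightarrow> 'u) \<Rightarrow> 'g monoid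
    \<Rightarrow> ('u set, 'u \<Rightarrow> 'u) comonad_data" where
  "K_comonad \<S> code G = \<lparr>endo = K_func code G,
     counit = (\<lambda>X\<in>\<S>. \<lambda>p\<in>power_set code G X. decode code G X p \<one>\<^bsub>G\<^esub>),
     comult = (\<lambda>X\<in>\<S>. \<lambda>p\<in>power_set code G X.
       code (\<lambda>g\<in>carrier G. code (\<lambda>h\<in>carrier G. decode code G X p (g \<otimes>\<^bsub>G\<^esub> h))))\<rparr>"

text \<open>\<open>\<Phi>\<close> is defined on the opposite category: an arrow \<open>H \<rightarrow> G\<close> there is a group morphism
  \<open>f : G \<rightarrow> H\<close>.\<close>

definition Phi :: "'u set set \<Rightarrow> (('g \<Rightarrow> 'u) \<Rightarrow> 'u)
    \<Rightarrow> ('g monoid, 'g \<Rightarrow> 'g, ('u set, 'u \<Rightarrow> 'u) comonad_data, 'u set \<Rightarrow> 'u \<Rightarrow> 'u) func" where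
  "Phi \<S> code = \<lparr>on_ob = K_comonad \<S> code,
     on_hom = (\<lambda>H G f. \<lambda>X\<in>\<S>. \<lambda>p\<in>power_set code H X.
       code (compose (carrier G) (decode code H X p) f))\<rparr>"

end

theory Submission
  imports Defs
begin

text \<open>Since \<open>K\<^sub>H\<close> is represented by \<open>H\<close>, the Yoneda lemma shows that every natural transformation
  \<open>K\<^sub>H \<Rightarrow> K\<^sub>G\<close> is precomposition with a unique map \<open>f : G \<rightarrow> H\<close>. Evaluated at \<open>p : H \<rightarrow> X\<close>, the two
  conditions on a morphism of comonads read \<open>p (f 1) = p 1\<close> and \<open>p (f (g h)) = p (f g f h)\<close>. For
  injective \<open>p\<close> they say that \<open>f\<close> is a group morphism.\<close>

section \<open>The category of comonads\<close>

text \<open>The assumption \<open>carrier_eqpoll\<close> supplies a set B in \<open>\<S>\<close> and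
  a bijection b from H onto B, which does two jobs: every element of every X^H is the image of b
  under some map B -> X, and injectivity of b turns equations between values into equations in H. A
  second obstacle is \<open>code\<close>: elements of X^G are points of type \<open>'u\<close>, so
  elements of (X^G)^G are coded twice. Equations between maps out of a power are tested on points
  \<open>code p\<close>, and injectivity of \<open>code\<close> strips the layers one by one. The
  comonad conditions are kept as an equivalence for an arbitrary map f: one direction makes \<Phi>
  well defined on arrows, the other makes it full.\<close>

lemma nat_transD:
  assumes "a \<in> nat_trans C D F G"
  shows nat_trans_extensional: "a \<in> extensional (Ob C)"
    and nat_trans_in_Hom: "X \<in> Ob C \<Longrightarrow> a X \<in> Hom D (on_ob F X) (on_ob G X)"
    and nat_trans_square: "\<lbrakk>X \<in> Ob C; Y \<in> Ob C; f \<in> Hom C X Y\<rbrakk> \<Longrightarrow>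
        Cmp D (on_ob F X) (on_ob F Y) (on_ob G Y) (a Y) (on_hom F X Y f)
      = Cmp D (on_ob F X) (on_ob G X) (on_ob G Y) (on_hom G X Y f) (a X)"
  using assms unfolding nat_trans_def by auto

lemma nat_trans_Idn:
  assumes "is_functor C D F"
  shows "(\<lambda>X\<in>Ob C. Idn D (on_ob F X)) \<in> nat_trans C D F F"
proof -
  interpret is_functor C D F by fact
  show ?thesis
    unfolding nat_trans_def
    by (auto simp: cod.Idn_in on_ob_in
        cod.Cmp_Idn_left[OF on_ob_in on_ob_in on_hom_in] cod.Cmp_Idn_right[OF on_ob_in on_ob_in on_hom_in])
qed

text \<open>The naturality squares of a and b at f are pasted along their common edge
  \<open>on_hom G X Y f\<close>; the other steps are rebracketing.\<close>

lemma nat_trans_Cmp: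
  assumes "is_functor C D F" "is_functor C D G" "is_functor C D H"
    and a: "a \<in> nat_trans C D F G" and b: "b \<in> nat_trans C D G H"
  shows "(\<lambda>X\<in>Ob C. Cmp D (on_ob F X) (on_ob G X) (on_ob H X) (b X) (a X)) \<in> nat_trans C D F H"
proof -
  interpret F: is_functor C D F by fact
  interpret G: is_functor C D G by fact
  interpret H: is_functor C D H by fact
  have "Cmp D (on_ob F X) (on_ob F Y) (on_ob H Y)
          (Cmp D (on_ob F Y) (on_ob G Y) (on_ob H Y) (b Y) (a Y)) (on_hom F X Y f)
      = Cmp D (on_ob F X) (on_ob H X) (on_ob H Y) (on_hom H X Y f)
          (Cmp D (on_ob F X) (on_ob G X) (on_ob H X) (b X) (a X))"
    if X: "X \<in> Ob C" and Y: "Y \<in> Ob C" and f: "f \<in> Hom C X Y" for X Y f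
  proof -
    note [simp] = F.on_ob_in[OF X] F.on_ob_in[OF Y] G.on_ob_in[OF X] G.on_ob_in[OF Y]
      H.on_ob_in[OF X] H.on_ob_in[OF Y]
    note homs = F.on_hom_in[OF X Y f] G.on_hom_in[OF X Y f] H.on_hom_in[OF X Y f]
      nat_trans_in_Hom[OF a X] nat_trans_in_Hom[OF a Y]
      nat_trans_in_Hom[OF b X] nat_trans_in_Hom[OF b Y]
    have "Cmp D (on_ob F X) (on_ob F Y) (on_ob H Y)
          (Cmp D (on_ob F Y) (on_ob G Y) (on_ob H Y) (b Y) (a Y)) (on_hom F X Y f)
      = Cmp D (on_ob F X) (on_ob G Y) (on_ob H Y) (b Y)
          (Cmp D (on_ob F X) (on_ob F Y) (on_ob G Y) (a Y) (on_hom F X Y f))"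
      by (rule F.cod.Cmp_assoc) (use homs in simp_all)
    also have "\<dots> = Cmp D (on_ob F X) (on_ob G Y) (on_ob H Y) (b Y)
          (Cmp D (on_ob F X) (on_ob G X) (on_ob G Y) (on_hom G X Y f) (a X))"
      by (simp only: nat_trans_square[OF a X Y f])
    also have "\<dots> = Cmp D (on_ob F X) (on_ob G X) (on_ob H Y)
          (Cmp D (on_ob G X) (on_ob G Y) (on_ob H Y) (b Y) (on_hom G X Y f)) (a X)"
      by (rule F.cod.Cmp_assoc[symmetric]) (use homs in simp_all)
    also have "\<dots> = Cmp D (on_ob F X) (on_ob G X) (on_ob H Y)
          (Cmp D (on_ob G X) (on_ob H X) (on_ob H Y) (on_hom H X Y f) (b X)) (a X)"
      by (simp only: nat_trans_square[OF b X Y f])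
    also have "\<dots> = Cmp D (on_ob F X) (on_ob H X) (on_ob H Y) (on_hom H X Y f)
          (Cmp D (on_ob F X) (on_ob G X) (on_ob H X) (b X) (a X))"
      by (rule F.cod.Cmp_assoc) (use homs in simp_all)
    finally show ?thesis .
  qed
  then show ?thesis
    unfolding nat_trans_def
    by (auto intro!: F.cod.Cmp_in F.on_ob_in G.on_ob_in H.on_ob_in
        nat_trans_in_Hom[OF a] nat_trans_in_Hom[OF b])
qed

text \<open>The interchange law, (ba)(ba) = (bb)(aa). It is what makes the comultiplication
  condition stable under composition of comonad morphisms.\<close>

lemma hcomp_Cmp:
  assumes K: "is_functor C C K" and L: "is_functor C C L" and M: "is_functor C C M"
    and a: "a \<in> nat_trans C C K L" and b: "b \<in> nat_trans C C L M"
    and c: "c = (\<lambda>X\<in>Ob C. Cmp C (on_ob K X) (on_ob L X) (on_ob M X) (b X) (a X))"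
    and X: "X \<in> Ob C"
  shows "hcomp C C K M K M c c X
    = Cmp C (on_ob K (on_ob K X)) (on_ob L (on_ob L X)) (on_ob M (on_ob M X))
        (hcomp C C L M L M b b X) (hcomp C C K L K L a a X)"
proof -
  interpret K: is_functor C C K by fact
  interpret L: is_functor C C L by fact
  interpret M: is_functor C C M by fact
  define KX where "KX = on_ob K X"
  define LX where "LX = on_ob L X"
  define MX where "MX = on_ob M X"
  have ob [simp]: "KX \<in> Ob C" "LX \<in> Ob C" "MX \<in> Ob C"
    using X by (simp_all add: KX_def LX_def MX_def K.on_ob_in L.on_ob_in M.on_ob_in)
  have aX: "a X \<in> Hom C KX LX" and bX: "b X \<in> Hom C LX MX"
    using nat_trans_in_Hom[OF a X] nat_trans_in_Hom[OF b X] by (simp_all add: KX_def LX_def MX_def)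
  note [simp] = K.on_ob_in L.on_ob_in M.on_ob_in
  note homs = K.on_hom_in[OF _ _ aX] K.on_hom_in[OF _ _ bX] L.on_hom_in[OF _ _ bX]
    nat_trans_in_Hom[OF a ob(2)] nat_trans_in_Hom[OF a ob(3)] nat_trans_in_Hom[OF b ob(3)]
  let ?C = "Cmp C"
  let ?Kb = "on_hom K LX MX (b X)" and ?Ka = "on_hom K KX LX (a X)" and ?Lb = "on_hom L LX MX (b X)"
  have "hcomp C C K M K M c c X
    = ?C (on_ob K KX) (on_ob K MX) (on_ob M MX)
        (?C (on_ob K MX) (on_ob L MX) (on_ob M MX) (b MX) (a MX))
        (on_hom K KX MX (?C KX LX MX (b X) (a X)))"
    using X ob by (simp add: hcomp_def c KX_def LX_def MX_def)
  also have "on_hom K KX MX (?C KX LX MX (b X) (a X))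
      = ?C (on_ob K KX) (on_ob K LX) (on_ob K MX) ?Kb ?Ka"
    by (rule K.on_hom_Cmp) (use aX bX in simp_all)
  also have "?C (on_ob K KX) (on_ob K MX) (on_ob M MX)
        (?C (on_ob K MX) (on_ob L MX) (on_ob M MX) (b MX) (a MX)) \<dots>
      = ?C (on_ob K KX) (on_ob L MX) (on_ob M MX) (b MX)
        (?C (on_ob K KX) (on_ob K MX) (on_ob L MX) (a MX)
          (?C (on_ob K KX) (on_ob K LX) (on_ob K MX) ?Kb ?Ka))"
    by (rule K.dom.Cmp_assoc) (use homs in \<open>simp_all add: K.dom.Cmp_in[of _ "on_ob K LX"]\<close>)
  also have "?C (on_ob K KX) (on_ob K MX) (on_ob L MX) (a MX)
          (?C (on_ob K KX) (on_ob K LX) (on_ob K MX) ?Kb ?Ka)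
      = ?C (on_ob K KX) (on_ob K LX) (on_ob L MX)
          (?C (on_ob K LX) (on_ob K MX) (on_ob L MX) (a MX) ?Kb) ?Ka"
    by (rule K.dom.Cmp_assoc[symmetric]) (use homs in simp_all)
  \<comment> \<open>Naturality of a at the arrow \<open>b X\<close> from LX to MX exchanges the two
    middle factors. After this only associativity is used.\<close>
  also have "?C (on_ob K LX) (on_ob K MX) (on_ob L MX) (a MX) ?Kb
      = ?C (on_ob K LX) (on_ob L LX) (on_ob L MX) ?Lb (a LX)"
    by (rule nat_trans_square[OF a _ _ bX]) simp_all
  also have "?C (on_ob K KX) (on_ob K LX) (on_ob L MX) \<dots> ?Ka
      = ?C (on_ob K KX) (on_ob L LX) (on_ob L MX) ?Lb
          (?C (on_ob K KX) (on_ob K LX) (on_ob L LX) (a LX) ?Ka)"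
    by (rule K.dom.Cmp_assoc) (use homs in simp_all)
  also have "?C (on_ob K KX) (on_ob L MX) (on_ob M MX) (b MX) \<dots>
      = ?C (on_ob K KX) (on_ob L LX) (on_ob M MX)
          (?C (on_ob L LX) (on_ob L MX) (on_ob M MX) (b MX) ?Lb)
          (?C (on_ob K KX) (on_ob K LX) (on_ob L LX) (a LX) ?Ka)"
    by (rule K.dom.Cmp_assoc[symmetric])
      (use homs in \<open>simp_all add: K.dom.Cmp_in[of _ "on_ob K LX"]\<close>)
  finally show ?thesis
    using X by (simp add: hcomp_def KX_def LX_def MX_def)
qed

lemma hcomp_in_Hom:
  assumes "is_functor C C K" "is_functor C C L" and a: "a \<in> nat_trans C C K L" and X: "X \<in> Ob C"
  shows "hcomp C C K L K L a a X \<in> Hom C (on_ob K (on_ob K X)) (on_ob L (on_ob L X))"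
proof -
  interpret K: is_functor C C K by fact
  interpret L: is_functor C C L by fact
  show ?thesis
    using X unfolding hcomp_def
    by (auto intro!: K.dom.Cmp_in K.on_ob_in L.on_ob_in K.on_hom_in nat_trans_in_Hom[OF a])
qed

section \<open>Identities and composites of comonad morphisms\<close>

lemma comonad_homD:
  assumes "a \<in> comonad_hom C K K'"
  shows comonad_hom_nat_trans: "a \<in> nat_trans C C (endo K) (endo K')"
    and comonad_hom_counit: "X \<in> Ob C \<Longrightarrow>
      Cmp C (on_ob (endo K) X) (on_ob (endo K') X) X (counit K' X) (a X) = counit K X"
    and comonad_hom_comult: "X \<in> Ob C \<Longrightarrow>
        Cmp C (on_ob (endo K) X) (on_ob (endo K') X) (on_ob (endo K') (on_ob (endo K') X))
          (comult K' X) (a X)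
      = Cmp C (on_ob (endo K) X) (on_ob (endo K) (on_ob (endo K) X))
          (on_ob (endo K') (on_ob (endo K') X))
          (hcomp C C (endo K) (endo K') (endo K) (endo K') a a X) (comult K X)"
  using assms unfolding comonad_hom_def by auto

lemma (in comonad) counit_in_Hom: "X \<in> Ob C \<Longrightarrow> counit K X \<in> Hom C (on_ob (endo K) X) X"
  using nat_trans_in_Hom[OF counit_nat] by (simp add: id_func_def)

lemma (in comonad) comult_in_Hom:
  "X \<in> Ob C \<Longrightarrow> comult K X \<in> Hom C (on_ob (endo K) X) (on_ob (endo K) (on_ob (endo K) X))"
  using nat_trans_in_Hom[OF comult_nat] by (simp add: comp_func_def)

lemma comonad_hom_Idn:
  assumes "comonad C K"
  shows "(\<lambda>X\<in>Ob C. Idn C (on_ob (endo K) X)) \<in> comonad_hom C K K"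
proof -
  interpret comonad C K by fact
  show ?thesis
    unfolding comonad_hom_def
    by (auto simp: nat_trans_Idn[OF is_functor_axioms] hcomp_def on_ob_in dom.Idn_in on_hom_Idn
        dom.Cmp_Idn_left dom.Cmp_Idn_right comult_in_Hom counit_in_Hom)
qed

text \<open>The conditions for a and b are chained. For the comultiplication this ends with
  (bb)(aa), which \<open>hcomp_Cmp\<close> identifies with the horizontal composite of c with
  itself.\<close>

lemma comonad_hom_Cmp:
  assumes "comonad C K" "comonad C L" "comonad C M"
    and a: "a \<in> comonad_hom C K L" and b: "b \<in> comonad_hom C L M"
    and c: "c = (\<lambda>X\<in>Ob C.
      Cmp C (on_ob (endo K) X) (on_ob (endo L) X) (on_ob (endo M) X) (b X) (a X))"
  shows "c \<in> comonad_hom C K M"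
proof -
  interpret K: comonad C K by fact
  interpret L: comonad C L by fact
  interpret M: comonad C M by fact
  note fs = K.is_functor_axioms L.is_functor_axioms M.is_functor_axioms
  note an = comonad_hom_nat_trans[OF a] and bn = comonad_hom_nat_trans[OF b]
  note [simp] = K.on_ob_in L.on_ob_in M.on_ob_in
  have c_nat: "c \<in> nat_trans C C (endo K) (endo M)"
    unfolding c by (rule nat_trans_Cmp[OF fs an bn])
  moreover have "Cmp C (on_ob (endo K) X) (on_ob (endo M) X) X (counit M X) (c X) = counit K X"
    if X: "X \<in> Ob C" for X
  proof -
    let ?C = "Cmp C" and ?K = "on_ob (endo K) X" and ?L = "on_ob (endo L) X"
      and ?M = "on_ob (endo M) X"
    have "?C ?K ?M X (counit M X) (c X) = ?C ?K ?L X (?C ?L ?M X (counit M X) (b X)) (a X)"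
      using X nat_trans_in_Hom[OF an X] nat_trans_in_Hom[OF bn X]
      by (simp add: c K.dom.Cmp_assoc M.counit_in_Hom)
    then show ?thesis
      using X by (simp add: comonad_hom_counit[OF a] comonad_hom_counit[OF b])
  qed
  moreover have "Cmp C (on_ob (endo K) X) (on_ob (endo M) X) (on_ob (endo M) (on_ob (endo M) X))
          (comult M X) (c X)
      = Cmp C (on_ob (endo K) X) (on_ob (endo K) (on_ob (endo K) X))
          (on_ob (endo M) (on_ob (endo M) X))
          (hcomp C C (endo K) (endo M) (endo K) (endo M) c c X) (comult K X)"
    if X: "X \<in> Ob C" for X
  proof -
    let ?C = "Cmp C" and ?K = "on_ob (endo K) X" and ?L = "on_ob (endo L) X"
      and ?M = "on_ob (endo M) X"
    let ?KK = "on_ob (endo K) ?K" and ?LL = "on_ob (endo L) ?L" and ?MM = "on_ob (endo M) ?M"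
    let ?a = "hcomp C C (endo K) (endo L) (endo K) (endo L) a a X"
      and ?b = "hcomp C C (endo L) (endo M) (endo L) (endo M) b b X"
    note homs = nat_trans_in_Hom[OF an X] nat_trans_in_Hom[OF bn X]
      hcomp_in_Hom[OF fs(1,2) an X] hcomp_in_Hom[OF fs(2,3) bn X]
      K.comult_in_Hom[OF X] L.comult_in_Hom[OF X] M.comult_in_Hom[OF X]
    have "?C ?K ?M ?MM (comult M X) (c X) = ?C ?K ?L ?MM (?C ?L ?M ?MM (comult M X) (b X)) (a X)"
      using X homs by (simp add: c K.dom.Cmp_assoc)
    also have "?C ?L ?M ?MM (comult M X) (b X) = ?C ?L ?LL ?MM ?b (comult L X)"
      by (rule comonad_hom_comult[OF b X])
    also have "?C ?K ?L ?MM \<dots> (a X) = ?C ?K ?LL ?MM ?b (?C ?K ?L ?LL (comult L X) (a X))"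
      by (rule K.dom.Cmp_assoc) (use X homs in simp_all)
    also have "?C ?K ?L ?LL (comult L X) (a X) = ?C ?K ?KK ?LL ?a (comult K X)"
      by (rule comonad_hom_comult[OF a X])
    also have "?C ?K ?LL ?MM ?b \<dots> = ?C ?K ?KK ?MM (?C ?KK ?LL ?MM ?b ?a) (comult K X)"
      by (rule K.dom.Cmp_assoc[symmetric]) (use X homs in simp_all)
    finally show ?thesis
      by (simp only: hcomp_Cmp[OF fs an bn c X])
  qed
  ultimately show ?thesis
    unfolding comonad_hom_def by blast
qed

text \<open>Composition is componentwise, so each law is the law of C at every object. Families are
  extensional on \<open>Ob C\<close>, hence agreement of components there is equality.\<close>

lemma category_Comonads: "category (Comonads C)"
proof
  fix K assume "K \<in> Ob (Comonads C)"
  then show "Idn (Comonads C) K \<in> Hom (Comonads C) K K"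
    by (simp add: Comonads_def comonad_hom_Idn)
next
  fix K L M a b
  assume "K \<in> Ob (Comonads C)" "L \<in> Ob (Comonads C)" "M \<in> Ob (Comonads C)"
    "a \<in> Hom (Comonads C) K L" "b \<in> Hom (Comonads C) L M"
  then show "Cmp (Comonads C) K L M b a \<in> Hom (Comonads C) K M"
    by (auto simp: Comonads_def intro: comonad_hom_Cmp)
next
  fix K L a
  assume "K \<in> Ob (Comonads C)" "L \<in> Ob (Comonads C)" "a \<in> Hom (Comonads C) K L"
  then interpret K: comonad C K + L: comonad C L unfolding Comonads_def by auto
  have a: "a \<in> nat_trans C C (endo K) (endo L)"
    using \<open>a \<in> _\<close> by (simp add: Comonads_def comonad_hom_nat_trans)
  show "Cmp (Comonads C) K L L (Idn (Comonads C) L) a = a"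
    "Cmp (Comonads C) K K L a (Idn (Comonads C) K) = a"
    by (auto simp: Comonads_def K.dom.Cmp_Idn_left K.dom.Cmp_Idn_right K.on_ob_in L.on_ob_in
        nat_trans_in_Hom[OF a]
        intro!: extensionalityI[OF restrict_extensional nat_trans_extensional[OF a]])
next
  fix K L M N a b c
  assume *: "K \<in> Ob (Comonads C)" "L \<in> Ob (Comonads C)" "M \<in> Ob (Comonads C)"
    "N \<in> Ob (Comonads C)"
    "a \<in> Hom (Comonads C) K L" "b \<in> Hom (Comonads C) L M" "c \<in> Hom (Comonads C) M N"
  then interpret K: comonad C K + L: comonad C L + M: comonad C M + N: comonad C N
    unfolding Comonads_def by auto
  have a: "a \<in> nat_trans C C (endo K) (endo L)" and b: "b \<in> nat_trans C C (endo L) (endo M)"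
    and c: "c \<in> nat_trans C C (endo M) (endo N)"
    using * by (simp_all add: Comonads_def comonad_hom_nat_trans)
  have "Cmp C (on_ob (endo K) X) (on_ob (endo L) X) (on_ob (endo N) X)
        (Cmp C (on_ob (endo L) X) (on_ob (endo M) X) (on_ob (endo N) X) (c X) (b X)) (a X)
      = Cmp C (on_ob (endo K) X) (on_ob (endo M) X) (on_ob (endo N) X) (c X)
        (Cmp C (on_ob (endo K) X) (on_ob (endo L) X) (on_ob (endo M) X) (b X) (a X))"
    if "X \<in> Ob C" for X
    using that by (intro K.dom.Cmp_assoc K.on_ob_in L.on_ob_in M.on_ob_in N.on_ob_in
        nat_trans_in_Hom[OF a] nat_trans_in_Hom[OF b] nat_trans_in_Hom[OF c])
  then show "Cmp (Comonads C) K L N (Cmp (Comonads C) L M N c b) a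
      = Cmp (Comonads C) K M N c (Cmp (Comonads C) K L M b a)"
    by (simp add: Comonads_def cong: restrict_cong)
qed

section \<open>The concrete categories\<close>

lemma category_Set_cat: "category (Set_cat \<S>)"
  by unfold_locales
    (auto simp: Set_cat_def compose_def fun_eq_iff restrict_def PiE_iff extensional_def)

lemma category_Grp_cat: "category (Grp_cat \<G>)"
proof
  fix G H L f g
  assume "G \<in> Ob (Grp_cat \<G>)" "H \<in> Ob (Grp_cat \<G>)" "L \<in> Ob (Grp_cat \<G>)"
    "f \<in> Hom (Grp_cat \<G>) G H" "g \<in> Hom (Grp_cat \<G>) H L"
  then show "Cmp (Grp_cat \<G>) G H L g f \<in> Hom (Grp_cat \<G>) G L"
    by (auto simp: Grp_cat_def group.hom_compose)
next
  fix G
  assume "G \<in> Ob (Grp_cat \<G>)"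
  then show "Idn (Grp_cat \<G>) G \<in> Hom (Grp_cat \<G>) G G"
    by (auto simp: Grp_cat_def hom_def group.is_monoid monoid.m_closed)
qed (auto simp: Grp_cat_def hom_def compose_def fun_eq_iff restrict_def extensional_def Pi_iff)

lemma category_op_cat:
  assumes "category C"
  shows "category (op_cat C)"
proof -
  interpret category C by fact
  show ?thesis
    by unfold_locales (simp_all add: op_cat_def Idn_in Cmp_in Cmp_Idn_left Cmp_Idn_right Cmp_assoc)
qed

lemma Set_cat_simps [simp]:
  "Ob (Set_cat \<S>) = \<S>" "Hom (Set_cat \<S>) X Y = X \<rightarrow>\<^sub>E Y" "Idn (Set_cat \<S>) X = (\<lambda>x\<in>X. x)"
  "Cmp (Set_cat \<S>) X Y Z g f = compose X g f"
  by (simp_all add: Set_cat_def)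

section \<open>The comonads of powers\<close>

text \<open>The value \<delta>(p)(g) of the comultiplication, before any coding.\<close>

definition shift :: "('g, 'r) monoid_scheme \<Rightarrow> ('g \<Rightarrow> 'u) \<Rightarrow> 'g \<Rightarrow> 'g \<Rightarrow> 'u" where
  "shift G p g = (\<lambda>h\<in>carrier G. p (g \<otimes>\<^bsub>G\<^esub> h))"

text \<open>The function \<delta>(p) with its values coded, since they have to be points of X^G. The
  outer code is added in \<open>comult_code\<close>.\<close>

definition shifts :: "(('g \<Rightarrow> 'u) \<Rightarrow> 'u) \<Rightarrow> ('g, 'r) monoid_scheme \<Rightarrow> ('g \<Rightarrow> 'u) \<Rightarrow> 'g \<Rightarrow> 'u" where
  "shifts code G p = (\<lambda>g\<in>carrier G. code (shift G p g))"

lemma shift_apply: "h \<in> carrier G \<Longrightarrow> shift G p g h = p (g \<otimes>\<^bsub>G\<^esub> h)"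
  by (simp add: shift_def)

lemma shifts_apply: "g \<in> carrier G \<Longrightarrow> shifts code G p g = code (shift G p g)"
  by (simp add: shifts_def)

lemma shift_extensional: "shift G p g \<in> extensional (carrier G)"
  by (simp add: shift_def)

lemma shifts_extensional: "shifts code G p \<in> extensional (carrier G)"
  by (simp add: shifts_def)

lemma (in monoid) shift_in_PiE:
  "\<lbrakk>p \<in> carrier G \<rightarrow>\<^sub>E X; g \<in> carrier G\<rbrakk> \<Longrightarrow> shift G p g \<in> carrier G \<rightarrow>\<^sub>E X"
  by (auto simp: shift_def)

text \<open>Associativity of the multiplication, in the form that yields coassociativity.\<close>

lemma (in monoid) shift_shift:
  "\<lbrakk>g \<in> carrier G; h \<in> carrier G\<rbrakk> \<Longrightarrow> shift G (shift G p g) h = shift G p (g \<otimes> h)"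
  by (auto simp: shift_def m_assoc)

text \<open>The left unit law, in the form that yields \<open>counit_left\<close>. A shift is cut
  off outside the carrier, so p has to be extensional.\<close>

lemma (in monoid) shift_one: "p \<in> carrier G \<rightarrow>\<^sub>E X \<Longrightarrow> shift G p \<one> = p"
  by (auto simp: shift_def PiE_iff intro!: extensionalityI[where A = "carrier G"])

lemma compose_in_PiE: "\<lbrakk>p \<in> A \<rightarrow>\<^sub>E B; f \<in> B \<rightarrow>\<^sub>E D\<rbrakk> \<Longrightarrow> compose A f p \<in> A \<rightarrow>\<^sub>E D"
  by (auto simp: compose_def)

section \<open>Power functors, computed on codes\<close>

context set_universe
begin

context
  fixes G :: "'g monoid"
  assumes G: "carrier G \<in> \<G>"
begin

lemma power_set_in: "X \<in> \<S> \<Longrightarrow> power_set code G X \<in> \<S>"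
  using code_in[OF G] by (simp add: power_set_def)

lemma code_in_power_set: "p \<in> carrier G \<rightarrow>\<^sub>E X \<Longrightarrow> code p \<in> power_set code G X"
  by (simp add: power_set_def)

lemma power_setE:
  assumes "x \<in> power_set code G X"
  obtains p where "p \<in> carrier G \<rightarrow>\<^sub>E X" "x = code p"
  using assms by (auto simp: power_set_def)

lemma decode_code: "\<lbrakk>X \<in> \<S>; p \<in> carrier G \<rightarrow>\<^sub>E X\<rbrakk> \<Longrightarrow> decode code G X (code p) = p"
  unfolding decode_def by (rule inv_into_f_f[OF code_inj[OF G]])

lemma K_func_on_ob: "on_ob (K_func code G) = power_set code G"
  by (simp add: K_func_def)

lemma K_func_code: "\<lbrakk>X \<in> \<S>; p \<in> carrier G \<rightarrow>\<^sub>E X\<rbrakk> \<Longrightarrow>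
    on_hom (K_func code G) X Y f (code p) = code (compose (carrier G) f p)"
  by (simp add: K_func_def code_in_power_set decode_code)

lemma counit_code: "\<lbrakk>X \<in> \<S>; p \<in> carrier G \<rightarrow>\<^sub>E X\<rbrakk> \<Longrightarrow>
    counit (K_comonad \<S> code G) X (code p) = p \<one>\<^bsub>G\<^esub>"
  by (simp add: K_comonad_def code_in_power_set decode_code)

lemma comult_code: "\<lbrakk>X \<in> \<S>; p \<in> carrier G \<rightarrow>\<^sub>E X\<rbrakk> \<Longrightarrow> comult (K_comonad \<S> code G) X (code p)
    = code (shifts code G p)"
  by (simp add: K_comonad_def code_in_power_set decode_code shifts_def shift_def)

text \<open>Extensionality for maps out of X^G: each of its points is some \<open>code p\<close>,
  and on these the structure maps have closed forms free of \<open>decode\<close>.\<close>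

lemma power_set_fun_eqI:
  assumes "u \<in> extensional (power_set code G X)" "v \<in> extensional (power_set code G X)"
    and "\<And>p. p \<in> carrier G \<rightarrow>\<^sub>E X \<Longrightarrow> u (code p) = v (code p)"
  shows "u = v"
  using assms by (auto simp: power_set_def intro: extensionalityI)

lemma power_set_fun_eq_iff:
  assumes "u \<in> extensional (power_set code G X)" "v \<in> extensional (power_set code G X)"
  shows "u = v \<longleftrightarrow> (\<forall>p\<in>carrier G \<rightarrow>\<^sub>E X. u (code p) = v (code p))"
  using power_set_fun_eqI[OF assms] by auto

lemma power_set_fun_in:
  assumes "u \<in> extensional (power_set code G X)"
    and "\<And>p. p \<in> carrier G \<rightarrow>\<^sub>E X \<Longrightarrow> u (code p) \<in> Y"
  shows "u \<in> power_set code G X \<rightarrow>\<^sub>E Y"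
  using assms by (auto simp: power_set_def PiE_def)

lemma K_func_extensional: "on_hom (K_func code G) X Y f \<in> extensional (power_set code G X)"
  by (simp add: K_func_def)

lemma counit_extensional:
  "X \<in> \<S> \<Longrightarrow> counit (K_comonad \<S> code G) X \<in> extensional (power_set code G X)"
  by (simp add: K_comonad_def)

lemma comult_extensional:
  "X \<in> \<S> \<Longrightarrow> comult (K_comonad \<S> code G) X \<in> extensional (power_set code G X)"
  by (simp add: K_comonad_def)

lemma K_func_in_Hom: "\<lbrakk>X \<in> \<S>; f \<in> X \<rightarrow>\<^sub>E Y\<rbrakk> \<Longrightarrow>
    on_hom (K_func code G) X Y f \<in> power_set code G X \<rightarrow>\<^sub>E power_set code G Y"
  by (rule power_set_fun_in)
    (simp_all add: K_func_extensional K_func_code code_in_power_set compose_in_PiE)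

lemma is_functor_K_func: "is_functor (Set_cat \<S>) (Set_cat \<S>) (K_func code G)"
proof (intro is_functor.intro is_functor_axioms.intro category_Set_cat;
    unfold Set_cat_simps K_func_on_ob)
  fix X Y Z f g
  assume *: "X \<in> \<S>" "Y \<in> \<S>" "Z \<in> \<S>" "f \<in> X \<rightarrow>\<^sub>E Y" "g \<in> Y \<rightarrow>\<^sub>E Z"
  have "compose (carrier G) (compose X g f) p
      = compose (carrier G) g (compose (carrier G) f p)" if "p \<in> carrier G \<rightarrow>\<^sub>E X" for p
    using that by (auto simp: compose_def fun_eq_iff restrict_def)
  then show "on_hom (K_func code G) X Z (compose X g f)
      = compose (power_set code G X) (on_hom (K_func code G) Y Z g)
          (on_hom (K_func code G) X Y f)"
    using * by (intro power_set_fun_eqI[where X = X])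
      (simp_all add: K_func_extensional K_func_code compose_eq code_in_power_set compose_in_PiE)
next
  fix X assume *: "X \<in> \<S>"
  have "compose (carrier G) (\<lambda>x\<in>X. x) p = p" if "p \<in> carrier G \<rightarrow>\<^sub>E X" for p
    using that by (auto simp: compose_def fun_eq_iff restrict_def PiE_iff extensional_def)
  then show "on_hom (K_func code G) X X (\<lambda>x\<in>X. x) = (\<lambda>x\<in>power_set code G X. x)"
    using * by (intro power_set_fun_eqI[where X = X])
      (simp_all add: K_func_extensional K_func_code code_in_power_set)
qed (simp_all add: power_set_in K_func_in_Hom)

end

lemma K_comonad_endo: "endo (K_comonad \<S> code G) = K_func code G"
  by (simp add: K_comonad_def)

section \<open>Group laws as comonad laws\<close>

context
  fixes G :: "'g monoid"
  assumes G: "carrier G \<in> \<G>" and grp: "group G"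
begin

interpretation group G by (fact grp)

lemma counit_in_PiE: "X \<in> \<S> \<Longrightarrow> counit (K_comonad \<S> code G) X \<in> power_set code G X \<rightarrow>\<^sub>E X"
  by (rule power_set_fun_in[OF G]) (auto simp: counit_code G counit_extensional)

lemma shifts_in_PiE:
  "p \<in> carrier G \<rightarrow>\<^sub>E X \<Longrightarrow> shifts code G p \<in> carrier G \<rightarrow>\<^sub>E power_set code G X"
  by (auto simp: shifts_def intro!: code_in_power_set[OF G] shift_in_PiE)

lemma comult_in_PiE: "X \<in> \<S> \<Longrightarrow>
    comult (K_comonad \<S> code G) X \<in> power_set code G X \<rightarrow>\<^sub>E power_set code G (power_set code G X)"
  by (rule power_set_fun_in[OF G])
    (simp_all add: comult_code code_in_power_set G shifts_in_PiE comult_extensional)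

text \<open>On \<open>code p\<close> the two counit laws become the left and the right unit law of
  G, and coassociativity becomes associativity.\<close>

lemma comonad_K_comonad: "comonad (Set_cat \<S>) (K_comonad \<S> code G)"
proof (intro comonad.intro comonad_axioms.intro; (unfold K_comonad_endo K_func_on_ob[OF G])?)
  let ?P = "power_set code G" and ?K = "K_comonad \<S> code G"
  note simps = G K_func_on_ob K_func_code counit_code comult_code code_in_power_set power_set_in
    compose_eq compose_in_PiE shift_in_PiE shifts_in_PiE K_func_in_Hom counit_in_PiE comult_in_PiE
    K_func_extensional counit_extensional comult_extensional shift_apply shifts_apply
    shift_shift shift_one
  show "is_functor (Set_cat \<S>) (Set_cat \<S>) (K_func code G)"
    by (rule is_functor_K_func[OF G])
  have "compose (?P X) (counit ?K Y) (on_hom (K_func code G) X Y f)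
      = compose (?P X) f (counit ?K X)"
    if "X \<in> \<S>" "Y \<in> \<S>" "f \<in> X \<rightarrow>\<^sub>E Y" for X Y f
    by (rule power_set_fun_eqI[OF G, where X = X]) (use that in \<open>simp_all add: simps\<close>)
  then show "counit ?K \<in> nat_trans (Set_cat \<S>) (Set_cat \<S>) (K_func code G) id_func"
    by (simp add: nat_trans_def id_func_def K_func_on_ob[OF G] counit_in_PiE)
      (simp add: K_comonad_def)
  have "compose (?P X) (comult ?K Y) (on_hom (K_func code G) X Y f)
      = compose (?P X) (on_hom (K_func code G) (?P X) (?P Y) (on_hom (K_func code G) X Y f))
          (comult ?K X)"
    if "X \<in> \<S>" "Y \<in> \<S>" "f \<in> X \<rightarrow>\<^sub>E Y" for X Y f
  proof (rule power_set_fun_eqI[OF G, where X = X])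
    fix p assume p: "p \<in> carrier G \<rightarrow>\<^sub>E X"
    \<comment> \<open>Translation acts on the argument of p and f on its value, so they
      commute.\<close>
    have "shift G (compose (carrier G) f p) g = compose (carrier G) f (shift G p g)"
      if "g \<in> carrier G" for g
      using that by (auto simp: shift_def compose_def)
    then have "shifts code G (compose (carrier G) f p)
      = compose (carrier G) (on_hom (K_func code G) X Y f) (shifts code G p)"
      using that p
      by (intro extensionalityI[where A = "carrier G"]) (simp_all add: simps shifts_extensional)
    then show "compose (?P X) (comult ?K Y) (on_hom (K_func code G) X Y f) (code p)
      = compose (?P X) (on_hom (K_func code G) (?P X) (?P Y) (on_hom (K_func code G) X Y f))
          (comult ?K X) (code p)"
      using that p by (simp add: simps)
  qed simp_all
  then show "comult ?K \<in> nat_trans (Set_cat \<S>) (Set_cat \<S>) (K_func code G)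
      (comp_func (K_func code G) (K_func code G))"
    by (simp add: nat_trans_def comp_func_def K_func_on_ob[OF G] comult_in_PiE)
      (simp add: K_comonad_def)
  show "Cmp (Set_cat \<S>) KX KKX KX (counit ?K KX) (comult ?K X) = Idn (Set_cat \<S>) KX"
    if "X \<in> Ob (Set_cat \<S>)" "KX = ?P X" "KKX = ?P KX" for X KX KKX
    unfolding Set_cat_simps \<open>KX = _\<close>
    by (rule power_set_fun_eqI[OF G, where X = X]) (use that in \<open>simp_all add: simps\<close>)
  show "Cmp (Set_cat \<S>) KX KKX KX (on_hom (K_func code G) KX X (counit ?K X)) (comult ?K X)
      = Idn (Set_cat \<S>) KX"
    if "X \<in> Ob (Set_cat \<S>)" "KX = ?P X" "KKX = ?P KX" for X KX KKX
    unfolding Set_cat_simps \<open>KX = _\<close>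
  proof (rule power_set_fun_eqI[OF G, where X = X])
    fix p assume p: "p \<in> carrier G \<rightarrow>\<^sub>E X"
    \<comment> \<open>The right unit law: evaluating the translate by g at the unit gives p (g 1) =
      p g.\<close>
    have "compose (carrier G) (counit ?K X) (shifts code G p) = p"
      by (rule extensionalityI[where A = "carrier G"])
        (use that p in \<open>simp_all add: simps, simp add: PiE_iff\<close>)
    then show "compose (?P X) (on_hom (K_func code G) (?P X) X (counit ?K X)) (comult ?K X) (code p)
        = (\<lambda>x\<in>?P X. x) (code p)"
      using that p by (simp add: simps)
  qed simp_all
  show "Cmp (Set_cat \<S>) KX KKX KKKX (comult ?K KX) (comult ?K X)
        = Cmp (Set_cat \<S>) KX KKX KKKX (on_hom (K_func code G) KX KKX (comult ?K X)) (comult ?K X)"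
    if "X \<in> Ob (Set_cat \<S>)" "KX = ?P X" "KKX = ?P KX" "KKKX = ?P KKX" for X KX KKX KKKX
    unfolding Set_cat_simps \<open>KKX = _\<close> \<open>KX = _\<close>
  proof (rule power_set_fun_eqI[OF G, where X = X])
    fix p assume p: "p \<in> carrier G \<rightarrow>\<^sub>E X"
    \<comment> \<open>At h both sides are the code of the translate of p by the product g h, by
      \<open>shift_shift\<close>.\<close>
    have "shift G (shifts code G p) g = shifts code G (shift G p g)" if "g \<in> carrier G" for g
      using that by (intro extensionalityI[where A = "carrier G"])
        (simp_all add: simps shift_extensional shifts_extensional)
    then have "shifts code G (shifts code G p) = compose (carrier G) (comult ?K X) (shifts code G p)"
      using that p
      by (intro extensionalityI[where A = "carrier G"]) (simp_all add: simps shifts_extensional)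
    then show "compose (?P X) (comult ?K (?P X)) (comult ?K X) (code p)
        = compose (?P X) (on_hom (K_func code G) (?P X) (?P (?P X)) (comult ?K X)) (comult ?K X)
            (code p)"
      using that p by (simp add: simps)
  qed simp_all
qed

end


section \<open>Morphisms between the comonads of powers\<close>

lemma code_eq_iff: "\<lbrakk>C \<in> \<G>; X \<in> \<S>; p \<in> C \<rightarrow>\<^sub>E X; q \<in> C \<rightarrow>\<^sub>E X\<rbrakk> \<Longrightarrow> code p = code q \<longleftrightarrow> p = q"
  using inj_on_eq_iff[OF code_inj] by blast

lemma PiE_eq_iff: "\<lbrakk>p \<in> A \<rightarrow>\<^sub>E B; q \<in> A \<rightarrow>\<^sub>E B\<rbrakk> \<Longrightarrow> p = q \<longleftrightarrow> (\<forall>x\<in>A. p x = q x)"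
  by (auto intro: PiE_ext)

text \<open>A copy of the carrier inside the universe. Injectivity of b lets values of b separate
  elements of C; its inverse is used in the Yoneda argument.\<close>

lemma separating_map:
  assumes "C \<in> \<G>"
  obtains X b where "X \<in> \<S>" "b \<in> C \<rightarrow>\<^sub>E X" "bij_betw b C X"
proof -
  obtain X where X: "X \<in> \<S>" "X \<approx> C"
    using carrier_eqpoll[OF assms] by blast
  then obtain b where b: "bij_betw b C X"
    using eqpoll_sym eqpoll_def by blast
  show ?thesis
  proof
    show "X \<in> \<S>" by fact
    show "restrict b C \<in> C \<rightarrow>\<^sub>E X"
      using bij_betwE[OF b] by simp
    show "bij_betw (restrict b C) C X"
      using b by simp
  qed
qed

section \<open>Natural transformations between power functors\<close>

context
  fixes G H :: "'g monoid"
  assumes G: "carrier G \<in> \<G>" and H: "carrier H \<in> \<G>"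
begin

text \<open>Outside this context G and H become arguments in this order:
  \<open>Phi_hom G H f\<close> belongs to f from G to H, although the arrow of comonads runs from H
  to G.\<close>

abbreviation "Phi_hom \<equiv> on_hom (Phi \<S> code) H G"

lemma Phi_code: "\<lbrakk>X \<in> \<S>; p \<in> carrier H \<rightarrow>\<^sub>E X\<rbrakk> \<Longrightarrow>
    Phi_hom f X (code p) = code (compose (carrier G) p f)"
  by (simp add: Phi_def code_in_power_set[OF H] decode_code[OF H])

lemma Phi_extensional: "X \<in> \<S> \<Longrightarrow> Phi_hom f X \<in> extensional (power_set code H X)"
  by (simp add: Phi_def)

lemma Phi_in_PiE: "\<lbrakk>X \<in> \<S>; f \<in> carrier G \<rightarrow>\<^sub>E carrier H\<rbrakk> \<Longrightarrow>
    Phi_hom f X \<in> power_set code H X \<rightarrow>\<^sub>E power_set code G X"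
  by (rule power_set_fun_in[OF H])
    (simp_all add: Phi_extensional Phi_code code_in_power_set[OF G] compose_in_PiE)

text \<open>Precomposition with f and postcomposition with u act on opposite sides of p, so this is
  associativity of composition.\<close>

lemma Phi_nat_trans:
  assumes f: "f \<in> carrier G \<rightarrow>\<^sub>E carrier H"
  shows "Phi_hom f \<in> nat_trans (Set_cat \<S>) (Set_cat \<S>) (K_func code H) (K_func code G)"
proof -
  have "compose (power_set code H X) (Phi_hom f Y) (on_hom (K_func code H) X Y u)
      = compose (power_set code H X) (on_hom (K_func code G) X Y u) (Phi_hom f X)"
    if u: "X \<in> \<S>" "Y \<in> \<S>" "u \<in> X \<rightarrow>\<^sub>E Y" for X Y u
  proof (rule power_set_fun_eqI[OF H, where X = X])
    fix p assume p: "p \<in> carrier H \<rightarrow>\<^sub>E X"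
    have "compose (carrier G) (compose (carrier H) u p) f
        = compose (carrier G) u (compose (carrier G) p f)"
      using f by (auto simp: compose_def fun_eq_iff restrict_def)
    then show "compose (power_set code H X) (Phi_hom f Y) (on_hom (K_func code H) X Y u) (code p)
      = compose (power_set code H X) (on_hom (K_func code G) X Y u) (Phi_hom f X) (code p)"
      using f u p
      by (simp add: compose_eq code_in_power_set[OF H] K_func_code[OF G] K_func_code[OF H]
          Phi_code compose_in_PiE)
  qed simp_all
  then show ?thesis
    using f by (simp add: nat_trans_def K_func_on_ob[OF G] K_func_on_ob[OF H] Phi_in_PiE)
      (simp add: Phi_def)
qed

text \<open>The Yoneda lemma: a bijection \<open>b\<close> from \<open>H\<close> onto a set in the universe plays the part of the
  identity of \<open>H\<close>, the universal element of \<open>X \<mapsto> X\<^sup>H\<close>.\<close>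

lemma nat_trans_eq_Phi:
  assumes \<alpha>: "\<alpha> \<in> nat_trans (Set_cat \<S>) (Set_cat \<S>) (K_func code H) (K_func code G)"
  obtains f where "f \<in> carrier G \<rightarrow>\<^sub>E carrier H" "\<alpha> = Phi_hom f"
proof -
  obtain B b where B: "B \<in> \<S>" and b: "b \<in> carrier H \<rightarrow>\<^sub>E B" and bij: "bij_betw b (carrier H) B"
    using separating_map[OF H] .
  let ?b' = "inv_into (carrier H) b"
  have in_Hom: "\<alpha> X \<in> power_set code H X \<rightarrow>\<^sub>E power_set code G X" if "X \<in> \<S>" for X
    using nat_trans_in_Hom[OF \<alpha>] that by (simp add: K_func_on_ob[OF G] K_func_on_ob[OF H])
  obtain q where q: "q \<in> carrier G \<rightarrow>\<^sub>E B" "\<alpha> B (code b) = code q"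
    using PiE_mem[OF in_Hom[OF B] code_in_power_set[OF H b]] by (rule power_setE[OF G])
  \<comment> \<open>If \<alpha> is precomposition with f, then q is b after f; solving for f gives
    this composite.\<close>
  define f where "f = compose (carrier G) ?b' q"
  have b': "?b' x \<in> carrier H" if "x \<in> B" for x
    using bij that by (simp add: bij_betw_def inv_into_into)
  then have f: "f \<in> carrier G \<rightarrow>\<^sub>E carrier H"
    using q by (auto simp: f_def compose_def)
  moreover have "\<alpha> = Phi_hom f"
  proof (rule extensionalityI)
    show "\<alpha> \<in> extensional \<S>" "Phi_hom f \<in> extensional \<S>"
      using nat_trans_extensional[OF \<alpha>] by (simp_all add: Phi_def)
    fix X assume X: "X \<in> \<S>"
    show "\<alpha> X = Phi_hom f X"
    proof (rule power_set_fun_eqI[OF H, where X = X])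
      show "\<alpha> X \<in> extensional (power_set code H X)"
        using in_Hom[OF X] by (simp add: PiE_def)
      show "Phi_hom f X \<in> extensional (power_set code H X)"
        by (rule Phi_extensional[OF X])
      fix p assume p: "p \<in> carrier H \<rightarrow>\<^sub>E X"
      \<comment> \<open>The map B -> X that carries b to p. Naturality at u then determines \<alpha>
        at p from its value q at b.\<close>
      define u where "u = compose B p ?b'"
      have u: "u \<in> B \<rightarrow>\<^sub>E X"
        using p b' by (auto simp: u_def compose_def)
      have p_eq: "compose (carrier H) u b = p"
        using p b bij
        by (intro extensionalityI[where A = "carrier H"])
          (auto simp: u_def compose_eq bij_betw_def PiE_iff)
      have "compose (power_set code H B) (\<alpha> X) (on_hom (K_func code H) B X u) (code b)
          = compose (power_set code H B) (on_hom (K_func code G) B X u) (\<alpha> B) (code b)"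
        using nat_trans_square[OF \<alpha>, of B X u] B X u by (simp add: K_func_on_ob[OF H])
      then have "\<alpha> X (code p) = code (compose (carrier G) u q)"
        by (simp add: compose_eq code_in_power_set[OF H b] K_func_code[OF H B b] p_eq q(2)
            K_func_code[OF G B q(1)])
      also have "compose (carrier G) u q = compose (carrier G) p f"
        using q by (auto simp: u_def f_def compose_def PiE_iff intro!: restrict_ext)
      finally show "\<alpha> X (code p) = Phi_hom f X (code p)"
        by (simp add: Phi_code[OF X p])
    qed
  qed
  ultimately show ?thesis ..
qed

text \<open>One element suffices: at b the two transformations give b after f and b after f', and b
  is injective.\<close>

lemma Phi_inj:
  assumes f: "f \<in> carrier G \<rightarrow>\<^sub>E carrier H" and f': "f' \<in> carrier G \<rightarrow>\<^sub>E carrier H"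
    and eq: "Phi_hom f = Phi_hom f'"
  shows "f = f'"
proof -
  obtain B b where B: "B \<in> \<S>" and b: "b \<in> carrier H \<rightarrow>\<^sub>E B" and bij: "bij_betw b (carrier H) B"
    using separating_map[OF H] .
  have "Phi_hom f B (code b) = Phi_hom f' B (code b)"
    by (simp only: eq)
  then have "compose (carrier G) b f = compose (carrier G) b f'"
    using B b f f' by (simp add: Phi_code code_eq_iff[OF G] compose_in_PiE)
  then have "b (f g) = b (f' g)" if "g \<in> carrier G" for g
    using that by (metis compose_eq)
  then have "f g = f' g" if "g \<in> carrier G" for g
    using bij that PiE_mem[OF f] PiE_mem[OF f'] by (auto simp: bij_betw_def dest: inj_onD)
  then show ?thesis
    by (rule PiE_ext[OF f f'])
qed

section \<open>Comonad morphisms versus group morphisms\<close>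

context
  assumes grpG: "group G" and grpH: "group H"
begin

interpretation G: group G by (fact grpG)
interpretation H: group H by (fact grpH)

lemma Phi_comonad_hom_iff:
  assumes f: "f \<in> carrier G \<rightarrow>\<^sub>E carrier H"
  shows "Phi_hom f \<in> comonad_hom (Set_cat \<S>) (K_comonad \<S> code H) (K_comonad \<S> code G)
    \<longleftrightarrow> f \<in> hom G H"
proof -
  let ?P = "power_set code"
  have fG: "f g \<in> carrier H" if "g \<in> carrier G" for g
    using f that by auto
  have counit: "compose (?P H X) (counit (K_comonad \<S> code G) X) (Phi_hom f X)
        = counit (K_comonad \<S> code H) X
      \<longleftrightarrow> (\<forall>p\<in>carrier H \<rightarrow>\<^sub>E X. p (f \<one>\<^bsub>G\<^esub>) = p \<one>\<^bsub>H\<^esub>)" if X: "X \<in> \<S>" for X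
    using f by (subst power_set_fun_eq_iff[OF H, where X = X])
      (simp_all add: X counit_extensional[OF H] compose_eq code_in_power_set[OF H] Phi_code
        counit_code[OF G] counit_code[OF H] compose_in_PiE cong: ball_cong)
  \<comment> \<open>The inner composite on the right is the horizontal composite of
    \<open>Phi_hom f\<close> with itself, as \<open>hcomp\<close> unfolds it. On
    \<open>code p\<close>, the left side takes g, h to p (f (g h)) and the right side to p (f g f
    h), up to two layers of \<open>code\<close>.\<close>
  have comult: "compose (?P H X) (comult (K_comonad \<S> code G) X) (Phi_hom f X)
      = compose (?P H X)
          (compose (?P H (?P H X)) (Phi_hom f (?P G X))
            (on_hom (K_func code H) (?P H X) (?P G X) (Phi_hom f X)))
          (comult (K_comonad \<S> code H) X)
      \<longleftrightarrow> (\<forall>p\<in>carrier H \<rightarrow>\<^sub>E X. \<forall>g\<in>carrier G. \<forall>h\<in>carrier G.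
        p (f (g \<otimes>\<^bsub>G\<^esub> h)) = p (f g \<otimes>\<^bsub>H\<^esub> f h))" if X: "X \<in> \<S>" for X
  proof (subst power_set_fun_eq_iff[OF H, where X = X], simp, simp, rule ball_cong[OF refl])
    fix p assume p: "p \<in> carrier H \<rightarrow>\<^sub>E X"
    have PX: "?P G X \<in> \<S>" "?P H X \<in> \<S>"
      using X by (simp_all add: power_set_in[OF G] power_set_in[OF H])
    note PhiX = Phi_in_PiE[OF X f]
    note p' = compose_in_PiE[OF f p]
    note sh = shifts_in_PiE[OF G grpG p'] shifts_in_PiE[OF H grpH p]
    note sh' = compose_in_PiE[OF sh(2) PhiX]
    have "compose (?P H X) (comult (K_comonad \<S> code G) X) (Phi_hom f X) (code p)
        = code (shifts code G (compose (carrier G) p f))"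
      by (simp add: compose_eq code_in_power_set[OF H p] Phi_code[OF X p] comult_code[OF G X p'])
    moreover have "compose (?P H X)
          (compose (?P H (?P H X)) (Phi_hom f (?P G X))
            (on_hom (K_func code H) (?P H X) (?P G X) (Phi_hom f X)))
          (comult (K_comonad \<S> code H) X) (code p)
        = code (compose (carrier G) (compose (carrier H) (Phi_hom f X) (shifts code H p)) f)"
      by (simp add: compose_eq code_in_power_set[OF H p] comult_code[OF H X p]
          code_in_power_set[OF H sh(2)] K_func_code[OF H PX(2) sh(2)] Phi_code[OF PX(1) sh'])
    \<comment> \<open>The outer code is stripped here, over the set X^G; the inner one below, over
      X, separately for each g.\<close>
    moreover have "code (shifts code G (compose (carrier G) p f))
        = code (compose (carrier G) (compose (carrier H) (Phi_hom f X) (shifts code H p)) f)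
      \<longleftrightarrow> shifts code G (compose (carrier G) p f)
        = compose (carrier G) (compose (carrier H) (Phi_hom f X) (shifts code H p)) f"
      by (rule code_eq_iff[OF G PX(1) sh(1) compose_in_PiE[OF f sh']])
    moreover have "\<dots> \<longleftrightarrow> (\<forall>g\<in>carrier G. code (shift G (compose (carrier G) p f) g)
        = code (compose (carrier G) (shift H p (f g)) f))"
      using p fG by (subst PiE_eq_iff[OF sh(1) compose_in_PiE[OF f sh']])
        (simp add: shifts_apply compose_eq Phi_code[OF X] H.shift_in_PiE cong: ball_cong)
    moreover have "code (shift G (compose (carrier G) p f) g)
        = code (compose (carrier G) (shift H p (f g)) f)
      \<longleftrightarrow> (\<forall>h\<in>carrier G. p (f (g \<otimes>\<^bsub>G\<^esub> h)) = p (f g \<otimes>\<^bsub>H\<^esub> f h))" if g: "g \<in> carrier G" for g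
    proof -
      note s = G.shift_in_PiE[OF p' g] compose_in_PiE[OF f H.shift_in_PiE[OF p fG[OF g]]]
      show ?thesis
        unfolding code_eq_iff[OF G X s] PiE_eq_iff[OF s]
        using g fG by (simp add: shift_apply compose_eq cong: ball_cong)
    qed
    ultimately show "compose (?P H X) (comult (K_comonad \<S> code G) X) (Phi_hom f X) (code p)
      = compose (?P H X)
          (compose (?P H (?P H X)) (Phi_hom f (?P G X))
            (on_hom (K_func code H) (?P H X) (?P G X) (Phi_hom f X)))
          (comult (K_comonad \<S> code H) X) (code p)
      \<longleftrightarrow> (\<forall>g\<in>carrier G. \<forall>h\<in>carrier G. p (f (g \<otimes>\<^bsub>G\<^esub> h)) = p (f g \<otimes>\<^bsub>H\<^esub> f h))"
      by simp
  qed
  have "Phi_hom f \<in> comonad_hom (Set_cat \<S>) (K_comonad \<S> code H) (K_comonad \<S> code G)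
    \<longleftrightarrow> (\<forall>X\<in>\<S>. \<forall>p\<in>carrier H \<rightarrow>\<^sub>E X. p (f \<one>\<^bsub>G\<^esub>) = p \<one>\<^bsub>H\<^esub>)
      \<and> (\<forall>X\<in>\<S>. \<forall>p\<in>carrier H \<rightarrow>\<^sub>E X. \<forall>g\<in>carrier G. \<forall>h\<in>carrier G.
        p (f (g \<otimes>\<^bsub>G\<^esub> h)) = p (f g \<otimes>\<^bsub>H\<^esub> f h))"
    by (simp add: comonad_hom_def hcomp_def K_comonad_endo K_func_on_ob[OF G] K_func_on_ob[OF H]
        Phi_nat_trans[OF f] counit comult del: PiE_iff cong: ball_cong)
  also have "\<dots> \<longleftrightarrow> f \<in> hom G H"
  proof
    assume *: "(\<forall>X\<in>\<S>. \<forall>p\<in>carrier H \<rightarrow>\<^sub>E X. p (f \<one>\<^bsub>G\<^esub>) = p \<one>\<^bsub>H\<^esub>)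
      \<and> (\<forall>X\<in>\<S>. \<forall>p\<in>carrier H \<rightarrow>\<^sub>E X. \<forall>g\<in>carrier G. \<forall>h\<in>carrier G.
        p (f (g \<otimes>\<^bsub>G\<^esub> h)) = p (f g \<otimes>\<^bsub>H\<^esub> f h))"
    \<comment> \<open>The equations hold for every p; the instance p = b can be cancelled.\<close>
    obtain B b where B: "B \<in> \<S>" and b: "b \<in> carrier H \<rightarrow>\<^sub>E B" and bij: "bij_betw b (carrier H) B"
      using separating_map[OF H] .
    show "f \<in> hom G H"
    proof (rule homI)
      fix g h assume gh: "g \<in> carrier G" "h \<in> carrier G"
      then have "b (f (g \<otimes>\<^bsub>G\<^esub> h)) = b (f g \<otimes>\<^bsub>H\<^esub> f h)"
        using * B b by blast
      then show "f (g \<otimes>\<^bsub>G\<^esub> h) = f g \<otimes>\<^bsub>H\<^esub> f h"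
        using gh fG by (intro inj_onD[OF bij_betw_imp_inj_on[OF bij]]) simp_all
    qed (rule fG)
  next
    assume "f \<in> hom G H"
    then show "(\<forall>X\<in>\<S>. \<forall>p\<in>carrier H \<rightarrow>\<^sub>E X. p (f \<one>\<^bsub>G\<^esub>) = p \<one>\<^bsub>H\<^esub>)
      \<and> (\<forall>X\<in>\<S>. \<forall>p\<in>carrier H \<rightarrow>\<^sub>E X. \<forall>g\<in>carrier G. \<forall>h\<in>carrier G.
        p (f (g \<otimes>\<^bsub>G\<^esub> h)) = p (f g \<otimes>\<^bsub>H\<^esub> f h))"
      \<comment> \<open>Preservation of products gives the comultiplication condition; for groups it
        also forces f 1 = 1, which gives the counit condition.\<close>
      using hom_one[OF _ grpG grpH] by (auto simp: hom_mult)
  qed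
  finally show ?thesis .
qed

text \<open>Existence combines the Yoneda lemma with \<open>Phi_comonad_hom_iff\<close>; uniqueness
  is \<open>Phi_inj\<close>. Extensionality fixes f outside the carrier, so that uniqueness is meant
  for arrows of \<open>Grp_cat \<G>\<close>.\<close>

lemma comonad_hom_ex1_Phi:
  assumes \<alpha>: "\<alpha> \<in> comonad_hom (Set_cat \<S>) (K_comonad \<S> code H) (K_comonad \<S> code G)"
  shows "\<exists>!f. f \<in> hom G H \<inter> extensional (carrier G) \<and> \<alpha> = Phi_hom f"
proof -
  have hom_PiE: "f \<in> carrier G \<rightarrow>\<^sub>E carrier H" if "f \<in> hom G H \<inter> extensional (carrier G)" for f
    using that by (auto simp: hom_def PiE_def)
  obtain f where f: "f \<in> carrier G \<rightarrow>\<^sub>E carrier H" "\<alpha> = Phi_hom f"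
    using comonad_hom_nat_trans[OF \<alpha>] unfolding K_comonad_endo by (rule nat_trans_eq_Phi)
  then have "f \<in> hom G H \<inter> extensional (carrier G)"
    using \<alpha> Phi_comonad_hom_iff[OF f(1)] by (simp add: PiE_def)
  then show ?thesis
    using f(2) Phi_inj hom_PiE by blast
qed

end

end

section \<open>Functoriality of \<Phi>\<close>

lemma is_functor_Phi: "is_functor (op_cat (Grp_cat \<G>)) (Comonads (Set_cat \<S>)) (Phi \<S> code)"
proof (intro is_functor.intro is_functor_axioms.intro category_op_cat category_Grp_cat
    category_Comonads)
  fix G assume "G \<in> Ob (op_cat (Grp_cat \<G>))"
  then have G: "carrier G \<in> \<G>" "group G"
    by (simp_all add: op_cat_def Grp_cat_def)
  show "on_ob (Phi \<S> code) G \<in> Ob (Comonads (Set_cat \<S>))"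
    using comonad_K_comonad[OF G] by (simp add: Phi_def Comonads_def)
  have "Phi_hom G G (\<lambda>x\<in>carrier G. x) X = (\<lambda>x\<in>power_set code G X. x)" if X: "X \<in> \<S>" for X
  proof (rule power_set_fun_eqI[OF G(1), where X = X])
    fix p assume p: "p \<in> carrier G \<rightarrow>\<^sub>E X"
    then have "compose (carrier G) p (\<lambda>x\<in>carrier G. x) = p"
      by (auto simp: compose_def PiE_iff intro!: extensionalityI[where A = "carrier G"])
    then show "Phi_hom G G (\<lambda>x\<in>carrier G. x) X (code p) = (\<lambda>x\<in>power_set code G X. x) (code p)"
      using p by (simp add: Phi_code[OF G(1) G(1) X] code_in_power_set[OF G(1)])
  qed (simp_all add: Phi_extensional[OF G(1) G(1) X])
  then show "on_hom (Phi \<S> code) G G (Idn (op_cat (Grp_cat \<G>)) G)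
      = Idn (Comonads (Set_cat \<S>)) (on_ob (Phi \<S> code) G)"
    by (intro extensionalityI[where A = \<S>])
      (simp_all add: op_cat_def Grp_cat_def Comonads_def Phi_def K_comonad_def K_func_def)
next
  fix H G f
  assume *: "H \<in> Ob (op_cat (Grp_cat \<G>))" "G \<in> Ob (op_cat (Grp_cat \<G>))"
    "f \<in> Hom (op_cat (Grp_cat \<G>)) H G"
  then have G: "carrier G \<in> \<G>" "group G" and H: "carrier H \<in> \<G>" "group H"
    and f: "f \<in> hom G H" "f \<in> extensional (carrier G)"
    by (simp_all add: op_cat_def Grp_cat_def)
  then have "f \<in> carrier G \<rightarrow>\<^sub>E carrier H"
    by (simp add: hom_def PiE_def)
  then show "on_hom (Phi \<S> code) H G f
      \<in> Hom (Comonads (Set_cat \<S>)) (on_ob (Phi \<S> code) H) (on_ob (Phi \<S> code) G)"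
    using Phi_comonad_hom_iff[OF G(1) H(1) G(2) H(2)] f by (simp add: Comonads_def Phi_def)
next
  fix L H G f g
  assume *: "L \<in> Ob (op_cat (Grp_cat \<G>))" "H \<in> Ob (op_cat (Grp_cat \<G>))"
    "G \<in> Ob (op_cat (Grp_cat \<G>))"
    "f \<in> Hom (op_cat (Grp_cat \<G>)) L H" "g \<in> Hom (op_cat (Grp_cat \<G>)) H G"
  then have G: "carrier G \<in> \<G>" and H: "carrier H \<in> \<G>" and L: "carrier L \<in> \<G>"
    and f: "f \<in> carrier H \<rightarrow>\<^sub>E carrier L" and g: "g \<in> carrier G \<rightarrow>\<^sub>E carrier H"
    by (auto simp: op_cat_def Grp_cat_def hom_def PiE_def)
  have "Phi_hom G L (compose (carrier G) f g) X
      = compose (power_set code L X) (Phi_hom G H g X) (Phi_hom H L f X)" if X: "X \<in> \<S>" for X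
  proof (rule power_set_fun_eqI[OF L, where X = X])
    fix p assume p: "p \<in> carrier L \<rightarrow>\<^sub>E X"
    \<comment> \<open>Precomposing with f after g means precomposing with f and then with g, whence
      the contravariance.\<close>
    have "compose (carrier G) p (compose (carrier G) f g)
        = compose (carrier G) (compose (carrier H) p f) g"
      using g by (auto simp: compose_def fun_eq_iff restrict_def)
    then show "Phi_hom G L (compose (carrier G) f g) X (code p)
        = compose (power_set code L X) (Phi_hom G H g X) (Phi_hom H L f X) (code p)"
      using p f by (simp add: compose_eq code_in_power_set[OF L] Phi_code[OF G L X]
          Phi_code[OF H L X] Phi_code[OF G H X] compose_in_PiE)
  qed (simp_all add: Phi_extensional[OF G L X])
  then show "on_hom (Phi \<S> code) L G (Cmp (op_cat (Grp_cat \<G>)) L H G g f)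
      = Cmp (Comonads (Set_cat \<S>)) (on_ob (Phi \<S> code) L) (on_ob (Phi \<S> code) H)
          (on_ob (Phi \<S> code) G) (on_hom (Phi \<S> code) H G g) (on_hom (Phi \<S> code) L H f)"
    by (intro extensionalityI[where A = \<S>])
      (simp_all add: op_cat_def Grp_cat_def Comonads_def Phi_def K_comonad_def K_func_def)
qed

end

theorem proposition24:
  fixes \<G> :: "'g set set" and \<S> :: "'u set set" and code :: "('g \<Rightarrow> 'u) \<Rightarrow> 'u"
  assumes "set_universe \<G> \<S> code"
  shows "is_functor (op_cat (Grp_cat \<G>)) (Comonads (Set_cat \<S>)) (Phi \<S> code)
    \<and> full (op_cat (Grp_cat \<G>)) (Comonads (Set_cat \<S>)) (Phi \<S> code)
    \<and> (\<forall>G\<in>Ob (Grp_cat \<G>). \<forall>H\<in>Ob (Grp_cat \<G>).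
         \<forall>\<alpha>\<in>comonad_hom (Set_cat \<S>) (K_comonad \<S> code H) (K_comonad \<S> code G).
           \<exists>!f. f \<in> Hom (Grp_cat \<G>) G H \<and> \<alpha> = on_hom (Phi \<S> code) H G f)"
proof (intro conjI)
  interpret set_universe \<G> \<S> code by fact
  show "is_functor (op_cat (Grp_cat \<G>)) (Comonads (Set_cat \<S>)) (Phi \<S> code)"
    by (rule is_functor_Phi)
  show ex1: "\<forall>G\<in>Ob (Grp_cat \<G>). \<forall>H\<in>Ob (Grp_cat \<G>).
       \<forall>\<alpha>\<in>comonad_hom (Set_cat \<S>) (K_comonad \<S> code H) (K_comonad \<S> code G).
         \<exists>!f. f \<in> Hom (Grp_cat \<G>) G H \<and> \<alpha> = on_hom (Phi \<S> code) H G f"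
    using comonad_hom_ex1_Phi by (simp add: Grp_cat_def)
  have Phi_ob: "on_ob (Phi \<S> code) = K_comonad \<S> code"
    by (simp add: Phi_def)
  \<comment> \<open>Fullness is the existence half of \<open>ex1\<close>, read with arrows from H to
    G in the opposite category as group morphisms from G to H.\<close>
  show "full (op_cat (Grp_cat \<G>)) (Comonads (Set_cat \<S>)) (Phi \<S> code)"
    unfolding full_def
  proof (intro ballI)
    fix H G \<alpha>
    assume "H \<in> Ob (op_cat (Grp_cat \<G>))" "G \<in> Ob (op_cat (Grp_cat \<G>))"
      "\<alpha> \<in> Hom (Comonads (Set_cat \<S>)) (on_ob (Phi \<S> code) H) (on_ob (Phi \<S> code) G)"
    then have "\<exists>!f. f \<in> Hom (Grp_cat \<G>) G H \<and> \<alpha> = on_hom (Phi \<S> code) H G f"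
      using ex1 by (simp add: op_cat_def Comonads_def Phi_ob)
    then show "\<exists>f\<in>Hom (op_cat (Grp_cat \<G>)) H G. on_hom (Phi \<S> code) H G f = \<alpha>"
      by (auto simp: op_cat_def)
  qed
qed

end
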